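(* Let $\pi\colon(\Omega,\mathrm{pr})\to(\Omega',\mathrm{pr}')$ be a bundle of probability schemes, let $R=\mathbb{R}^{\Omega}$ and $R'=\mathbb{R}^{\Omega'}$, and regard $R$ as a (finite projective) $R'$-module through $\pi^{\sharp}$. Then for every $X\in R$ the transfer of $X$ is the relative trace of the multiplication map $m_X\colon R\to R$, $m_X(Y)=XY$: $$\pi_*X=\mathrm{Tr}_{R/R'}(m_X).$$
   Context: A (probability) scheme is a finite set $\Omega$ with a function $\mathrm{pr}\colon\Omega\to(0,\infty)$ such that $\sum_{\omega}\mathrm{pr}(\omega)=1$. $\mathbb{R}^{\Omega}$ is the real algebra of functions $\Omega\to\mathbb{R}$ under pointwise operations. A bundle is a map $\pi\colon\Omega\to\Omega'$ with $\mathrm{pr}'(\omega')=\sum_{\omega\in\pi^{-1}(\omega')}\mathrm{pr}(\omega)$ for all $\omega'\in\Omega'$ (hence surjective). The pullback is $\pi^{\sharp}\colon\mathbb{R}^{\Omega'}\to\mathbb{R}^{\Omega}$, $\pi^{\sharp}(Z)=Z\circ\pi$, and the transfer $\pi_*\colon\mathbb{R}^{\Omega}\to\mathbb{R}^{\Omega'}$ is $(\pi_*X)(\omega')=\sum_{\omega\in\pi^{-1}(\omega')}X(\omega)$. For an $R'$-linear map $L\colon R\to R$, $\mathrm{Tr}_{R/R'}(L)=\sum_i f_i(LY_i)\in R'$, where $Y_i\in R$, $f_i\in\mathrm{Hom}_{R'}(R,R')$ is any finite dual basis, i.e. $Y=\sum_i f_i(Y)Y_i$ for all $Y\in R$ (the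 value does not depend on the choice of dual basis); this is the usual categorical trace in the symmetric monoidal category of finite projective $R'$-modules. *)

theory Defs
  imports Complex_Main "HOL-Library.Function_Algebras"
begin

text \<open>
  The finite sets \<open>\<Omega>\<close>, \<open>\<Omega>'\<close> are rendered as types of class \<open>finite\<close>. The pointwise algebra of
  real functions on \<open>\<Omega>\<close> is the \<open>comm_ring_1\<close> instance of \<^theory>\<open>HOL-Library.Function_Algebras\<close>.
\<close>

definition prob_scheme :: "('a::finite \<Rightarrow> real) \<Rightarrow> bool" where
  "prob_scheme pr \<longleftrightarrow> (\<forall>w. 0 < pr w) \<and> (\<Sum>w\<in>UNIV. pr w) = 1"

definition scheme_bundle ::
    "('a::finite \<Rightarrow> real) \<Rightarrow> ('b::finite \<Rightarrow> real) \<Rightarrow> ('a \<Rightarrow> 'b) \<Rightarrow> bool" where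
  "scheme_bundle pr pr' \<pi> \<longleftrightarrow>
     prob_scheme pr \<and> prob_scheme pr' \<and> (\<forall>w'. pr' w' = (\<Sum>w \<in> \<pi> -` {w'}. pr w))"

definition pullback :: "('a \<Rightarrow> 'b) \<Rightarrow> ('b \<Rightarrow> real) \<Rightarrow> 'a \<Rightarrow> real" where
  "pullback \<pi> Z = Z \<circ> \<pi>"

definition transfer :: "('a::finite \<Rightarrow> 'b) \<Rightarrow> ('a \<Rightarrow> real) \<Rightarrow> 'b \<Rightarrow> real" where
  "transfer \<pi> X = (\<lambda>w'. \<Sum>w \<in> \<pi> -` {w'}. X w)"

definition pullback_scale ::
    "('a \<Rightarrow> 'b) \<Rightarrow> ('b \<Rightarrow> real) \<Rightarrow> ('a \<Rightarrow> real) \<Rightarrow> 'a \<Rightarrow> real" where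
  "pullback_scale \<pi> Z Y = pullback \<pi> Z * Y"

lemma module_pullback_scale: "module (pullback_scale \<pi>)"
  by unfold_locales (auto simp: pullback_scale_def pullback_def algebra_simps)

definition dual_basis ::
    "('r::comm_ring_1 \<Rightarrow> 'm::ab_group_add \<Rightarrow> 'm) \<Rightarrow> nat \<Rightarrow> (nat \<Rightarrow> 'm \<Rightarrow> 'r) \<Rightarrow> (nat \<Rightarrow> 'm) \<Rightarrow> bool" where
  "dual_basis scale n f Y \<longleftrightarrow>
     (\<forall>i<n. module_hom scale (*) (f i)) \<and> (\<forall>y. y = (\<Sum>i<n. scale (f i y) (Y i)))"

text \<open>
  The description below determines a value as soon as a dual basis exists, by
  \<open>rel_trace_eq\<close>; for the module \<open>pullback_scale \<pi>\<close> one exists by \<open>ex_dual_basis_pullback_scale\<close>.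
\<close>

definition rel_trace ::
    "('r::comm_ring_1 \<Rightarrow> 'm::ab_group_add \<Rightarrow> 'm) \<Rightarrow> ('m \<Rightarrow> 'm) \<Rightarrow> 'r" where
  "rel_trace scale L =
     (THE t. \<exists>n f Y. dual_basis scale n f Y \<and> t = (\<Sum>i<n. f i (L (Y i))))"

lemma module_hom_sum_scale:
  assumes "module_hom s1 s2 g"
  shows "g (\<Sum>i\<in>I. s1 (c i) (y i)) = (\<Sum>i\<in>I. s2 (c i) (g (y i)))"
proof -
  interpret module_hom s1 s2 g by fact
  show ?thesis by (simp add: sum scale)
qed

lemma dual_basis_trace_unique:
  assumes L: "module_hom scale scale L"
    and f: "dual_basis scale n f Y" and g: "dual_basis scale m g Z"
  shows "(\<Sum>i<n. f i (L (Y i))) = (\<Sum>j<m. g j (L (Z j)))"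
proof -
  have fh: "module_hom scale (*) (f i)" if "i < n" for i
    using f that by (simp add: dual_basis_def)
  have gh: "module_hom scale (*) (g j)" if "j < m" for j
    using g that by (simp add: dual_basis_def)
  have fe: "y = (\<Sum>i<n. scale (f i y) (Y i))" for y
    using f by (simp add: dual_basis_def)
  have ge: "y = (\<Sum>j<m. scale (g j y) (Z j))" for y
    using g by (simp add: dual_basis_def)
  have "f i (L (Y i)) = (\<Sum>j<m. g j (Y i) * f i (L (Z j)))" if "i < n" for i
  proof -
    have "L (Y i) = (\<Sum>j<m. scale (g j (Y i)) (L (Z j)))"
      by (subst ge[of "Y i"]) (rule module_hom_sum_scale[OF L])
    then show ?thesis
      by (simp add: module_hom_sum_scale[OF fh[OF that]])
  qed
  then have "(\<Sum>i<n. f i (L (Y i))) = (\<Sum>i<n. \<Sum>j<m. g j (Y i) * f i (L (Z j)))"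
    by simp
  also have "\<dots> = (\<Sum>j<m. \<Sum>i<n. f i (L (Z j)) * g j (Y i))"
    by (subst sum.swap) (simp add: mult.commute)
  also have "\<dots> = (\<Sum>j<m. g j (L (Z j)))"
  proof (rule sum.cong[OF refl])
    fix j assume "j \<in> {..<m}"
    then have "j < m" by simp
    show "(\<Sum>i<n. f i (L (Z j)) * g j (Y i)) = g j (L (Z j))"
      by (subst (2) fe[of "L (Z j)"]) (rule module_hom_sum_scale[OF gh[OF \<open>j < m\<close>], symmetric])
  qed
  finally show ?thesis .
qed

lemma rel_trace_eq:
  assumes "module_hom scale scale L" and "dual_basis scale n f Y"
  shows "rel_trace scale L = (\<Sum>i<n. f i (L (Y i)))"
  unfolding rel_trace_def
  by (rule the_equality) (use assms dual_basis_trace_unique in blast)+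

lemma module_hom_mult_pullback_scale:
  "module_hom (pullback_scale \<pi>) (pullback_scale \<pi>) (\<lambda>Y. X * Y)"
  by (auto simp: module_hom_iff module_pullback_scale pullback_scale_def algebra_simps)

lemma ex_dual_basis_pullback_scale:
  fixes \<pi> :: "'a::finite \<Rightarrow> 'b"
  shows "\<exists>n f Y. dual_basis (pullback_scale \<pi>) n f Y"
proof -
  obtain h :: "nat \<Rightarrow> 'a" where h: "bij_betw h {..<card (UNIV :: 'a set)} UNIV"
    using ex_bij_betw_nat_finite[of "UNIV :: 'a set"] by (auto simp: atLeast0LessThan)
  define f :: "nat \<Rightarrow> ('a \<Rightarrow> real) \<Rightarrow> 'b \<Rightarrow> real"
    where "f = (\<lambda>i Y w'. if \<pi> (h i) = w' then Y (h i) else 0)"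
  define Y :: "nat \<Rightarrow> 'a \<Rightarrow> real" where "Y = (\<lambda>i w. if w = h i then 1 else 0)"
  have "module ((*) :: ('b \<Rightarrow> real) \<Rightarrow> _)"
    by unfold_locales (auto simp: algebra_simps)
  then have "module_hom (pullback_scale \<pi>) (*) (f i)" for i
    by (auto simp: module_hom_iff module_pullback_scale f_def pullback_scale_def pullback_def)
  moreover have "y = (\<Sum>i<card (UNIV :: 'a set). pullback_scale \<pi> (f i y) (Y i))" for y
  proof
    fix w
    have app: "(\<Sum>i\<in>I. F i) w = (\<Sum>i\<in>I. F i w)" for I :: "nat set" and F :: "nat \<Rightarrow> 'a \<Rightarrow> real"
      by (induction I rule: infinite_finite_induct) auto
    have "(\<Sum>i<card (UNIV :: 'a set). pullback_scale \<pi> (f i y) (Y i)) w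
        = (\<Sum>i<card (UNIV :: 'a set). if w = h i then y (h i) else 0)"
      by (auto simp: app pullback_scale_def pullback_def f_def Y_def intro!: sum.cong)
    also have "\<dots> = (\<Sum>v\<in>UNIV. if w = v then y v else 0)"
      by (rule sum.reindex_bij_betw[OF h])
    finally show "y w = (\<Sum>i<card (UNIV :: 'a set). pullback_scale \<pi> (f i y) (Y i)) w"
      by simp
  qed
  ultimately show ?thesis unfolding dual_basis_def by blast
qed

end

theory Submission
  imports Defs
begin

text \<open>
  For any dual basis \<open>f\<^sub>i, Y\<^sub>i\<close>, expanding \<open>X Y\<^sub>i\<close> in the point masses \<open>\<delta>\<^sub>v\<close> of the finite set
  \<open>\<Omega>\<close> and using linearity gives
  \<open>\<Sum>\<^sub>i f\<^sub>i (X Y\<^sub>i) (w') = \<Sum>\<^sub>v [\<pi> v = w'] X v (\<Sum>\<^sub>i f\<^sub>i \<delta>\<^sub>v (w') Y\<^sub>i v)\<close>,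
  and the inner sum is \<open>\<delta>\<^sub>v v = 1\<close> by the dual basis property.
\<close>

lemma sum_fun_apply: "(\<Sum>i\<in>I. F i) w = (\<Sum>i\<in>I. F i w)"
  for F :: "'i \<Rightarrow> 'a \<Rightarrow> 'b::comm_monoid_add"
  by (induction I rule: infinite_finite_induct) auto

text \<open>Only the value of a coefficient at \<open>\<pi> v\<close> matters, because the point
  mass vanishes off \<open>v\<close>. Making it zero elsewhere is what later confines the sum to the
  fibre over \<open>w'\<close>.\<close>

lemma fun_eq_sum_pullback_scale_point_mass:
  fixes \<pi> :: "'a::finite \<Rightarrow> 'b" and y :: "'a \<Rightarrow> real"
  shows "y = (\<Sum>v\<in>UNIV. pullback_scale \<pi> (\<lambda>w'. if \<pi> v = w' then y v else 0) (\<lambda>w. of_bool (w = v)))"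
proof
  fix w
  have "(\<Sum>v\<in>UNIV. pullback_scale \<pi> (\<lambda>w'. if \<pi> v = w' then y v else 0) (\<lambda>w. of_bool (w = v))) w
      = (\<Sum>v\<in>UNIV. if w = v then y v else 0)"
    by (auto simp: sum_fun_apply pullback_scale_def pullback_def intro!: sum.cong)
  then show "y w = (\<Sum>v\<in>UNIV. pullback_scale \<pi> (\<lambda>w'. if \<pi> v = w' then y v else 0)
      (\<lambda>w. of_bool (w = v))) w"
    by simp
qed

lemma dual_basis_pullback_scale_trace:
  fixes \<pi> :: "'a::finite \<Rightarrow> 'b"
  assumes "dual_basis (pullback_scale \<pi>) n f Y"
  shows "(\<Sum>i<n. f i (X * Y i)) = transfer \<pi> X"
proof
  fix w'
  define \<delta> :: "'a \<Rightarrow> 'a \<Rightarrow> real" where "\<delta> = (\<lambda>v w. of_bool (w = v))"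
  have hom: "module_hom (pullback_scale \<pi>) (*) (f i)" if "i < n" for i
    using assms that by (simp add: dual_basis_def)
  \<comment> \<open>In every surviving term \<open>\<pi> v = w'\<close>, so
    \<open>f i (\<delta> v)\<close> may be evaluated at \<open>\<pi> v\<close>; the factor to be
    summed over \<open>i\<close> then no longer depends on \<open>w'\<close>.\<close>
  have expand: "f i (X * Y i) w' = (\<Sum>v\<in>UNIV. if \<pi> v = w' then X v * (f i (\<delta> v) (\<pi> v) * Y i v) else 0)"
    if "i < n" for i
  proof -
    have "f i (X * Y i) = (\<Sum>v\<in>UNIV. (\<lambda>w'. if \<pi> v = w' then (X * Y i) v else 0) * f i (\<delta> v))"
      by (subst fun_eq_sum_pullback_scale_point_mass[of "X * Y i" \<pi>])
         (simp only: \<delta>_def module_hom_sum_scale[OF hom[OF that]])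
    then show ?thesis
      by (auto simp: sum_fun_apply intro!: sum.cong)
  qed
  have unit: "(\<Sum>i<n. f i (\<delta> v) (\<pi> v) * Y i v) = 1" for v
  proof -
    have "\<delta> v = (\<Sum>i<n. pullback_scale \<pi> (f i (\<delta> v)) (Y i))"
      using assms by (simp add: dual_basis_def)
    from fun_cong[OF this, of v] show ?thesis
      by (simp add: sum_fun_apply pullback_scale_def pullback_def \<delta>_def)
  qed
  have "(\<Sum>i<n. f i (X * Y i)) w'
      = (\<Sum>i<n. \<Sum>v\<in>UNIV. if \<pi> v = w' then X v * (f i (\<delta> v) (\<pi> v) * Y i v) else 0)"
    by (simp add: sum_fun_apply expand)
  also have "\<dots> = (\<Sum>v\<in>UNIV. if \<pi> v = w' then X v * (\<Sum>i<n. f i (\<delta> v) (\<pi> v) * Y i v) else 0)"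
    by (subst sum.swap) (auto simp: sum_distrib_left intro!: sum.cong)
  also have "\<dots> = (\<Sum>v\<in>UNIV. if v \<in> \<pi> -` {w'} then X v else 0)"
    by (intro sum.cong) (auto simp: unit)
  also have "\<dots> = transfer \<pi> X w'"
    unfolding transfer_def by (subst sum.inter_restrict[symmetric]) simp_all
  finally show "(\<Sum>i<n. f i (X * Y i)) w' = transfer \<pi> X w'" .
qed

theorem mainTheorem6:
  fixes pr :: "'a::finite \<Rightarrow> real" and pr' :: "'b::finite \<Rightarrow> real"
    and \<pi> :: "'a \<Rightarrow> 'b" and X :: "'a \<Rightarrow> real"
  assumes "scheme_bundle pr pr' \<pi>"
  shows "transfer \<pi> X = rel_trace (pullback_scale \<pi>) (\<lambda>Y. X * Y)"
proof -
  \<comment> \<open>The dual basis can stay abstract: the trace sum has been computed for all of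
    them.\<close>
  obtain n f Y where "dual_basis (pullback_scale \<pi>) n f Y"
    using ex_dual_basis_pullback_scale by blast
  then show ?thesis
    by (simp add: rel_trace_eq[OF module_hom_mult_pullback_scale] dual_basis_pullback_scale_trace)
qed

end
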